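(* Let $X$ be a nonnegative random variable with distribution function $F$ and $\mathbb E X=\infty$. Let $c,(k_n),\ell_1,A,\ell,\delta,M_R$ be as in the context (with $\alpha=1$), and assume that for all sufficiently large $x$ $$1-F(x)=\frac{\ell(x)}{x}\,[M_R(\delta(x))+h_R(x)],$$ where $h_R$ is right-continuous and $\lim_{n\to\infty}h_R(A_{k_n}x)=0$ for every continuity point $x>0$ of $M_R$. Let $U(y)=\sum_{n=0}^\infty F^{*n}(y)$ be the renewal function ($F^{*n}$ the $n$-fold convolution power) and $L(x)=\int_1^x(1-F(u))\,\mathrm du$. Then $$U(y)\sim\frac{y}{L(y)}\qquad\text{as } y\to\infty .$$
   Context: $a(y)\sim b(y)$ means $a(y)/b(y)\to1$. Setting (with $\alpha=1$): $c>1$; $(k_n)_{n\ge1}$ is a strictly increasing sequence of positive integers with $k_{n+1}/k_n\to c$. $\ell_1:[1,\infty)\to(0,\infty)$ is slowly varying at infinity, $A(x)=A_x=x\,\ell_1(x)$, and for large $x$ the slowly varying function $\ell$ is defined by $x^{-1}\ell(x)=\sup\{t\in(0,1]: t^{-1}\ell_1(1/t)>x\}$. For all large $x$ there is a unique $k_n$ with $A_{k_n}\le x<A_{k_{n+1}}$, and $\delta(x)=x/A_{k_n}$. $M_R:(0,\infty)\to(0,\infty)$ is bounded, bounded away from $0$, right-continuous, not constant, satisfies $M_R(cx)=M_R(x)$ for all $x>0$, and $x\mapsto M_R(x)/x$ is nonincreasing. *)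

theory Defs
  imports "HOL-Probability.Probability" "HOL-Library.Landau_Symbols"
begin

(* Slow variation at infinity for f : [a, oo) -> (0, oo). As usual in the theory of
   regular variation, measurability is part of the notion. *)
definition slowly_varying :: "real \<Rightarrow> (real \<Rightarrow> real) \<Rightarrow> bool" where
  "slowly_varying a f \<longleftrightarrow>
     f \<in> borel_measurable (lebesgue_on {a..}) \<and>
     (\<forall>x\<ge>a. f x > 0) \<and>
     (\<forall>r>0. ((\<lambda>x. f (r * x) / f x) \<longlongrightarrow> 1) at_top)"

definition A_fun :: "(real \<Rightarrow> real) \<Rightarrow> real \<Rightarrow> real" where
  "A_fun l1 x = x * l1 x"

(* Only the values at large x matter; the Sup is then over a nonempty subset of (0,1]. *)
definition ell :: "(real \<Rightarrow> real) \<Rightarrow> real \<Rightarrow> real" where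
  "ell l1 x = x * Sup {t \<in> {0<..1}. inverse t * l1 (1 / t) > x}"

(* The index n is uniquely determined for all large x when l1 is slowly varying and
   k (n + 1) / k n tends to some c > 1. Sequences are indexed from 1; k 0 plays no role. *)
definition delta :: "(real \<Rightarrow> real) \<Rightarrow> (nat \<Rightarrow> nat) \<Rightarrow> real \<Rightarrow> real" where
  "delta l1 k x =
     x / A_fun l1 (real (k (THE n. n \<ge> 1 \<and>
       A_fun l1 (real (k n)) \<le> x \<and> x < A_fun l1 (real (k (n + 1))))))"

primrec conv_power :: "real measure \<Rightarrow> nat \<Rightarrow> real measure" where
  "conv_power \<mu> 0 = return borel 0"
| "conv_power \<mu> (Suc n) = convolution \<mu> (conv_power \<mu> n)"

(* For a law on [0, oo) other than the point mass at 0 this series converges. *)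
definition renewal_function :: "real measure \<Rightarrow> real \<Rightarrow> real" where
  "renewal_function \<mu> y = (\<Sum>n. cdf (conv_power \<mu> n) y)"

end

theory Submission
  imports Defs
begin

text \<open>
  Write \<open>m(v)\<close> for the truncated mean \<open>E (min X v)\<close> and \<open>S\<^sub>n\<close> for the random walk with steps
  distributed as \<open>X\<close>, so that \<open>U(y) = \<Sum>n. P(S\<^sub>n \<le> y)\<close> and \<open>L(y) = m(y) - m(1)\<close>. The walk
  satisfies an exact balance: one more step lowers the mean of \<open>(y - S\<^sub>n)\<^sup>+\<close> by the
  mean of \<open>m((y - S\<^sub>n)\<^sup>+)\<close>. Summed over \<open>n\<close>, these losses exhaust the initial value \<open>y\<close>.
  Since \<open>m\<close> is monotone, bounding the losses by \<open>m(y)\<close> from above, and by \<open>m(v)\<close> from below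
  on the event \<open>y + v - S\<^sub>n \<ge> v\<close>, gives for \<open>y, v > 0\<close>
    \<open>y \<le> m(y) U(y)\<close>  and  \<open>m(v) U(y) \<le> y + v\<close>
  (\<open>renewal_function_lower\<close>, \<open>renewal_function_upper\<close>). If \<open>m\<close> is slowly varying, then
  \<open>v = \<epsilon> y\<close> makes the two bounds agree up to a factor \<open>1 + \<epsilon>\<close> in the limit, hence
  \<open>U(y) m(y) / y \<longlonglongrightarrow> 1\<close>. As \<open>E X = \<infinity>\<close> means \<open>m(y) \<longlonglongrightarrow> \<infinity>\<close>, replacing \<open>m\<close> by \<open>L\<close> changes nothing.

  Slow variation of \<open>m\<close> follows from \<open>x (1 - F(x)) / m(x) \<longlonglongrightarrow> 0\<close>. The difficulty is that the error
  \<open>h\<^sub>R\<close> is controlled only along the sequences \<open>A(k\<^sub>n) x\<close>, with no uniformity in \<open>x\<close>. Monotonicity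
  of the tail makes a single such sequence sufficient. Fix one continuity point \<open>x\<^sub>0\<close> of \<open>M\<^sub>R\<close>, which
  exists because \<open>M\<^sub>R(x) / x\<close> is monotone, and put \<open>z\<^sub>n = A(k\<^sub>n) x\<^sub>0\<close>. There \<open>1 - F\<close> lies between two
  positive multiples of \<open>s(x) = \<ell>(x) / x\<close>, and since \<open>z\<^sub>n\<^sub>+\<^sub>1 / z\<^sub>n \<longlonglongrightarrow> c\<close> the tail at any other point is
  controlled by its values at the neighbouring \<open>z\<^sub>n\<close>. Now \<open>p\<^sub>n = z\<^sub>n s(z\<^sub>n)\<close> cannot grow at a
  geometric rate, while \<open>m\<close> increases by at least a constant multiple of \<open>p\<^sub>n\<close> over each step of the
  skeleton. Thus \<open>m(z\<^sub>n)\<close> dominates the sum of arbitrarily many terms comparable to \<open>p\<^sub>n\<close>, so that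
  \<open>p\<^sub>n / m(z\<^sub>n) \<longlonglongrightarrow> 0\<close> (\<open>negligible_increment\<close>, \<open>tail_negligible_from_skeleton\<close>).

  Two properties of \<open>\<ell>\<^sub>1\<close> enter. That \<open>A(k\<^sub>n\<^sub>+\<^sub>1) / A(k\<^sub>n) \<longlonglongrightarrow> c\<close> requires the uniform convergence
  theorem, as the ratios \<open>k\<^sub>n\<^sub>+\<^sub>1 / k\<^sub>n\<close> vary with \<open>n\<close> (\<open>slowly_varying_ratio_seq\<close>). The slow growth of
  \<open>p\<^sub>n\<close> follows from slow variation at one ratio at a time (\<open>inverse_scale_decay\<close>), once
  \<open>s(x) \<longlonglongrightarrow> 0\<close> is known; this last fact comes from the tail hypothesis, since slow
  variation does not prevent \<open>\<ell>\<^sub>1\<close> from being unbounded on a bounded set.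
\<close>

section \<open>Locally uniform convergence for slowly varying functions\<close>

text \<open>The uniform convergence theorem, with \<open>H\<close> in the role of \<open>ln \<circ> l\<close> for a slowly varying \<open>l\<close>. The idea is
to average: by dominated convergence, \<open>D(x)\<close>, the integral of \<open>min 1 \<bar>H(s x) - H(x)\<bar>\<close> over
\<open>1 \<le> s \<le> T + 1\<close>, tends to \<open>0\<close>. For \<open>t\<close> in \<open>[1, T]\<close>, the triangle inequality through the points \<open>s x\<close>
with \<open>t \<le> s \<le> T + 1\<close>, integrated over this interval of length at least \<open>1\<close>, bounds the truncated
increment by \<open>D(x) + T D(t x)\<close>, which is small uniformly in \<open>t\<close>.\<close>

lemma uniform_convergence_additive:
  fixes H :: "real \<Rightarrow> real"
  assumes H [measurable]: "H \<in> borel_measurable lebesgue"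
    and lim: "\<And>r. 0 < r \<Longrightarrow> ((\<lambda>x. H (r * x) - H x) \<longlongrightarrow> 0) at_top"
    and T: "1 \<le> T" and e: "0 < e"
  shows "\<forall>\<^sub>F x in at_top. \<forall>t\<in>{1..T}. \<bar>H (t * x) - H x\<bar> < e"
proof -
  define g where "g x s = min 1 \<bar>H (s * x) - H x\<bar> * indicator {1..T+1} s" for x s
  define D where "D x = (\<integral>s. g x s \<partial>lebesgue)" for x
  have H_scaled [measurable]: "(\<lambda>s. H (s * x)) \<in> borel_measurable lebesgue" for x
    using measurable_compose[OF lebesgue_measurable_scaling[of x] H] by (simp add: mult.commute)
  have g_meas [measurable]: "g x \<in> borel_measurable lebesgue" for x
    unfolding g_def
    by (intro borel_measurable_times borel_measurable_min borel_measurable_abs borel_measurable_diff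
        H_scaled borel_measurable_const borel_measurable_indicator) auto
  have g_nonneg: "0 \<le> g x s" for x s by (simp add: g_def)
  have dom: "integrable lebesgue (indicator {1..T+1} :: real \<Rightarrow> real)"
    by (simp add: emeasure_lborel_Icc_eq)
  have g_bound: "norm (g x s) \<le> indicator {1..T+1} s" for x s
    by (auto simp: g_def indicator_def)
  have g_int: "integrable lebesgue (g x)" for x
    by (rule Bochner_Integration.integrable_bound[OF dom]) (use g_bound in auto)
  have "(D \<longlongrightarrow> (\<integral>s. 0 \<partial>(lebesgue :: real measure))) at_top"
    unfolding D_def
  proof (rule integral_dominated_convergence_at_top[where s = g and f = "\<lambda>_. 0",
        OF borel_measurable_const g_meas dom])
    have "((\<lambda>x. g x s) \<longlongrightarrow> 0) at_top" for s
    proof (cases "s \<in> {1..T+1}")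
      case True
      then have "((\<lambda>x. min 1 \<bar>H (s * x) - H x\<bar>) \<longlongrightarrow> min 1 \<bar>0\<bar>) at_top"
        by (intro tendsto_intros lim) auto
      then show ?thesis using True by (simp add: g_def)
    qed (simp add: g_def)
    then show "AE s in lebesgue. ((\<lambda>x. g x s) \<longlongrightarrow> 0) at_top" by simp
  qed (use g_bound in auto)
  then have D: "(D \<longlongrightarrow> 0) at_top" by simp
  have key: "min 1 \<bar>H (t * x) - H x\<bar> \<le> D x + T * D (t * x)" if t: "t \<in> {1..T}" for t x
  proof -
    define \<delta> where "\<delta> = min 1 \<bar>H (t * x) - H x\<bar>"
    have \<delta>: "0 \<le> \<delta>" by (simp add: \<delta>_def)
    have D_nonneg: "0 \<le> D z" for z unfolding D_def by (intro Bochner_Integration.integral_nonneg g_nonneg)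
    have Dnn: "(\<integral>\<^sup>+s. ennreal (g z s) \<partial>lebesgue) = ennreal (D z)" for z
      unfolding D_def by (rule nn_integral_eq_integral[OF g_int]) (simp add: g_nonneg)
    have gt [measurable]: "(\<lambda>s. g z (s / t)) \<in> borel_measurable lebesgue" for z
      using measurable_compose[OF lebesgue_measurable_scaling[of "1 / t"] g_meas] by simp
    \<comment> \<open>The length of \<open>[t, T + 1]\<close> is at least \<open>1\<close>.\<close>
    have "ennreal \<delta> \<le> (\<integral>\<^sup>+s. ennreal \<delta> * indicator {t..T+1} s \<partial>lebesgue)"
    proof -
      have "ennreal \<delta> * 1 \<le> ennreal \<delta> * ennreal (T + 1 - t)"
        using t by (intro mult_left_mono) auto
      then show ?thesis using t by (simp add: nn_integral_cmult_indicator)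
    qed
    also have "\<dots> \<le> (\<integral>\<^sup>+s. ennreal (g x s) + ennreal (g (t * x) (s / t)) \<partial>lebesgue)"
    proof (rule nn_integral_mono)
      fix s
      show "ennreal \<delta> * indicator {t..T+1} s \<le> ennreal (g x s) + ennreal (g (t * x) (s / t))"
      proof (cases "s \<in> {t..T+1}")
        case True
        have "s \<le> (T + 1) * 1" using True by simp
        also have "\<dots> \<le> (T + 1) * t" using t by (intro mult_left_mono) auto
        finally have "s \<le> (T + 1) * t" .
        then have "s / t \<le> T + 1" "1 \<le> s / t"
          using t True by (auto simp: pos_divide_le_eq pos_le_divide_eq)
        moreover have "s / t * (t * x) = s * x" using t by simp
        ultimately have "\<delta> \<le> g x s + g (t * x) (s / t)"
          using True t unfolding g_def \<delta>_def by (auto simp: min_def)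
        then show ?thesis using True g_nonneg by (simp flip: ennreal_plus)
      qed simp
    qed
    also have "\<dots> = ennreal (D x) + (\<integral>\<^sup>+s. ennreal (g (t * x) (s / t)) \<partial>lebesgue)"
      by (subst nn_integral_add) (auto simp: Dnn)
    also have "(\<integral>\<^sup>+s. ennreal (g (t * x) (s / t)) \<partial>lebesgue) = ennreal t * ennreal (D (t * x))"
      using t by (subst nn_integral_real_affine_lebesgue[where c = t and t = 0]) (auto simp: Dnn)
    also have "ennreal (D x) + ennreal t * ennreal (D (t * x)) = ennreal (D x + t * D (t * x))"
      using t D_nonneg by (simp add: ennreal_mult)
    finally have "\<delta> \<le> D x + t * D (t * x)"
      using t D_nonneg by (subst (asm) ennreal_le_iff) auto
    also have "\<dots> \<le> D x + T * D (t * x)" using t D_nonneg by (simp add: mult_right_mono)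
    finally show ?thesis by (simp add: \<delta>_def)
  qed
  have "\<forall>\<^sub>F x in at_top. D x < min 1 e / (1 + T)"
    by (rule order_tendstoD(2)[OF D]) (use e T in auto)
  then obtain X where X: "\<And>x. X \<le> x \<Longrightarrow> D x < min 1 e / (1 + T)"
    unfolding eventually_at_top_linorder by blast
  show ?thesis
    using eventually_ge_at_top[of "max 0 X"]
  proof eventually_elim
    case (elim x)
    show ?case
    proof
      fix t assume t: "t \<in> {1..T}"
      then have "x \<le> t * x" using elim by (auto simp: mult_le_cancel_right1)
      then have "D x < min 1 e / (1 + T)" "D (t * x) < min 1 e / (1 + T)"
        using X elim by auto
      then have "D x + T * D (t * x) < min 1 e / (1 + T) + T * (min 1 e / (1 + T))"
        using T by (intro add_strict_mono mult_strict_left_mono) auto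
      also have "\<dots> = (1 + T) * (min 1 e / (1 + T))" by (simp only: distrib_right mult_1)
      also have "\<dots> = min 1 e" using T by simp
      finally show "\<bar>H (t * x) - H x\<bar> < e" using key[OF t, of x] by (auto simp: min_def split: if_splits)
    qed
  qed
qed

text \<open>The case in which the multiplier varies with \<open>n\<close> but eventually stays in a compact subset of \<open>(0, \<infinity>)\<close>; this is
where measurability of \<open>l\<close> is used, through the uniform convergence theorem.\<close>

lemma slowly_varying_ratio_seq:
  fixes u v :: "nat \<Rightarrow> real"
  assumes l: "slowly_varying a l" and u: "filterlim u at_top sequentially"
    and ratio: "(\<lambda>n. v n / u n) \<longlonglongrightarrow> q" and q: "1 < q"
  shows "(\<lambda>n. l (v n) / l (u n)) \<longlonglongrightarrow> 1"
proof -
  define H where "H x = (if a \<le> x then ln (l x) else 0)" for x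
  have lpos: "\<And>x. a \<le> x \<Longrightarrow> 0 < l x" using l by (simp add: slowly_varying_def)
  have "(\<lambda>x. ln (l x)) \<in> borel_measurable (lebesgue_on {a..})"
    using l by (simp add: slowly_varying_def borel_measurable_ln)
  then have H_meas: "H \<in> borel_measurable lebesgue"
    unfolding H_def by (subst (asm) borel_measurable_if_lebesgue_on[symmetric]) (auto simp: if_distrib)
  have H_lim: "((\<lambda>x. H (r * x) - H x) \<longlongrightarrow> 0) at_top" if r: "0 < r" for r
  proof -
    have "((\<lambda>x. ln (l (r * x) / l x)) \<longlongrightarrow> ln 1) at_top"
      using l r by (intro tendsto_ln) (auto simp: slowly_varying_def)
    moreover have "\<forall>\<^sub>F x in at_top. ln (l (r * x) / l x) = H (r * x) - H x"
      using eventually_ge_at_top[of a] eventually_ge_at_top[of "a / r"]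
    proof eventually_elim
      case (elim x)
      then have "a \<le> r * x" using r by (simp add: field_simps)
      then show ?case using elim lpos[of x] lpos[of "r * x"] by (simp add: H_def ln_div)
    qed
    ultimately show ?thesis by (simp add: tendsto_cong)
  qed
  have "(\<lambda>n. H (v n) - H (u n)) \<longlonglongrightarrow> 0"
  proof (rule LIMSEQ_I[unfolded real_norm_def], goal_cases)
    case (1 e)
    have unif: "\<forall>\<^sub>F n in sequentially. \<forall>t\<in>{1..q+1}. \<bar>H (t * u n) - H (u n)\<bar> < e"
      by (rule eventually_compose_filterlim[OF uniform_convergence_additive[OF H_meas H_lim] u])
         (use q 1 in auto)
    have "\<forall>\<^sub>F n in sequentially. \<bar>H (v n) - H (u n)\<bar> < e"
      using unif order_tendstoD(1)[OF ratio q] order_tendstoD(2)[OF ratio, of "q + 1", simplified]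
        filterlim_at_top_dense[THEN iffD1, OF u, rule_format, of 0]
    proof eventually_elim
      case (elim n)
      then have "\<bar>H (v n / u n * u n) - H (u n)\<bar> < e" by (intro bspec[OF elim(1)]) auto
      then show ?case using elim by simp
    qed
    then show ?case by (simp add: eventually_sequentially)
  qed
  then have "(\<lambda>n. exp (H (v n) - H (u n))) \<longlonglongrightarrow> exp 0" by (rule tendsto_exp)
  moreover have "\<forall>\<^sub>F n in sequentially. exp (H (v n) - H (u n)) = l (v n) / l (u n)"
    using filterlim_at_top[THEN iffD1, OF u, rule_format, of a]
      filterlim_at_top_dense[THEN iffD1, OF u, rule_format, of 0] order_tendstoD(1)[OF ratio q]
  proof eventually_elim
    case (elim n)
    then have "u n \<le> v n" by (simp add: field_simps)
    then show ?case using elim lpos[of "u n"] lpos[of "v n"] by (simp add: H_def exp_diff)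
  qed
  ultimately show ?thesis by (simp add: tendsto_cong)
qed

section \<open>Sequences with a limiting ratio larger than one\<close>

lemma ratio_limit_at_top:
  fixes z :: "nat \<Rightarrow> real"
  assumes pos: "\<forall>\<^sub>F n in sequentially. 0 < z n"
    and ratio: "(\<lambda>n. z (Suc n) / z n) \<longlonglongrightarrow> c" and c: "1 < c"
  shows "filterlim z at_top sequentially"
proof -
  define q where "q = (1 + c) / 2"
  have q: "1 < q" "q < c" using c by (auto simp: q_def)
  have "\<forall>\<^sub>F n in sequentially. 0 < z n \<and> q < z (Suc n) / z n"
    using pos order_tendstoD(1)[OF ratio q(2)] by eventually_elim auto
  then obtain N where N: "\<And>n. N \<le> n \<Longrightarrow> 0 < z n \<and> q < z (Suc n) / z n"
    unfolding eventually_sequentially by blast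
  have "summable (\<lambda>n. inverse (z n))"
  proof (rule summable_ratio_test[of "1 / q" N])
    fix n assume n: "N \<le> n"
    then have "0 < z n" "0 < z (Suc n)" "q < z (Suc n) / z n" using N[of n] N[of "Suc n"] by auto
    then have "0 < z n" "0 < z (Suc n)" "q * z n \<le> z (Suc n)" by (auto simp: pos_less_divide_eq)
    then show "norm (inverse (z (Suc n))) \<le> 1 / q * norm (inverse (z n))"
      using q by (simp add: field_simps)
  qed (use q in auto)
  then have "(\<lambda>n. inverse (z n)) \<longlonglongrightarrow> 0" by (rule summable_LIMSEQ_zero)
  then have "filterlim (\<lambda>n. inverse (inverse (z n))) at_top sequentially"
    by (rule filterlim_inverse_at_top) (use pos in \<open>auto elim!: eventually_mono\<close>)
  then show ?thesis by simp
qed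

lemma bracketing_index:
  fixes z :: "nat \<Rightarrow> real"
  assumes z: "filterlim z at_top sequentially" and "z N \<le> x"
  shows "\<exists>n\<ge>N. z n \<le> x \<and> x < z (Suc n)"
proof -
  have "\<forall>\<^sub>F n in sequentially. N \<le> n \<and> x < z (Suc n)"
    using filterlim_at_top_dense[THEN iffD1, OF filterlim_compose[OF z filterlim_Suc], rule_format, of x]
      eventually_ge_at_top[of N] by eventually_elim auto
  then have ex: "\<exists>n. N \<le> n \<and> x < z (Suc n)" by (auto simp: eventually_sequentially)
  define n where "n = (LEAST n. N \<le> n \<and> x < z (Suc n))"
  have n: "N \<le> n" "x < z (Suc n)"
    using LeastI_ex[OF ex] by (auto simp: n_def)
  have "z n \<le> x"
  proof (cases "n = N")
    case False
    then obtain m where m: "n = Suc m" "N \<le> m" using n(1) by (cases n) auto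
    then have "\<not> (N \<le> m \<and> x < z (Suc m))"
      using not_less_Least[of m "\<lambda>n. N \<le> n \<and> x < z (Suc n)"] by (simp add: n_def)
    then show ?thesis using m by auto
  qed (use assms in simp)
  then show ?thesis using n by blast
qed

text \<open>From the first index on at which the sequence increases for good, the brackets are disjoint and cover a
half-line. The finitely many earlier terms are avoided by taking \<open>x\<close> above their maximum.\<close>

lemma unique_bracketing_index:
  fixes z :: "nat \<Rightarrow> real"
  assumes pos: "\<And>n. 1 \<le> n \<Longrightarrow> 0 < z n"
    and ratio: "(\<lambda>n. z (Suc n) / z n) \<longlonglongrightarrow> c" and c: "1 < c"
  shows "\<forall>\<^sub>F x in at_top. \<exists>!n. 1 \<le> n \<and> z n \<le> x \<and> x < z (Suc n)"
proof -
  have pos': "\<forall>\<^sub>F n in sequentially. 0 < z n"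
    using eventually_ge_at_top[of 1] by eventually_elim (rule pos)
  have lim: "filterlim z at_top sequentially" by (rule ratio_limit_at_top[OF pos' ratio c])
  have "\<forall>\<^sub>F n in sequentially. 1 \<le> n \<and> z n < z (Suc n)"
    using eventually_ge_at_top[of 1] order_tendstoD(1)[OF ratio c]
    by eventually_elim (use pos in \<open>auto simp: field_simps\<close>)
  then obtain N where N1: "1 \<le> N" and inc: "\<And>n. N \<le> n \<Longrightarrow> z n < z (Suc n)"
    unfolding eventually_sequentially by (metis order_refl)
  have mono: "z m \<le> z n" if "N \<le> m" "m \<le> n" for m n
    using that(2,1) by (induction rule: dec_induct) (auto intro: order_trans[OF _ less_imp_le[OF inc]])
  define X where "X = Max (z ` {..N})"
  have X: "z n \<le> X" if "n \<le> N" for n using that by (auto simp: X_def intro!: Max_ge)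
  show ?thesis
    using eventually_ge_at_top[of X]
  proof eventually_elim
    case (elim x)
    have late: "N \<le> n" if "x < z (Suc n)" for n
      using X[of "Suc n"] elim that by (cases "Suc n \<le> N") auto
    obtain n where n: "N \<le> n" "z n \<le> x" "x < z (Suc n)"
      using bracketing_index[OF lim, of N x] X[of N] elim by auto
    show ?case
    proof (rule ex1I[of _ n])
      fix m assume m: "1 \<le> m \<and> z m \<le> x \<and> x < z (Suc m)"
      then have "N \<le> m" using late by blast
      show "m = n"
      proof (rule ccontr)
        assume "m \<noteq> n"
        then consider "Suc m \<le> n" | "Suc n \<le> m" by linarith
        then show False
          using mono[of "Suc m" n] mono[of "Suc n" m] m n \<open>N \<le> m\<close> by cases auto
      qed
    qed (use n N1 in auto)
  qed
qed

text \<open>For \<open>v\<^sub>n = m\<^sub>n / p\<^sub>n\<close> the assumptions say that eventually \<open>v\<^sub>n\<^sub>+\<^sub>1 \<ge> \<kappa> + \<theta> v\<^sub>n\<close> for every \<open>\<theta> < 1\<close>. So an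
eventual lower bound \<open>a\<close> on \<open>v\<close> improves to \<open>\<kappa> + \<theta> a\<close>, which exceeds \<open>a + \<kappa> / 2\<close> for \<open>\<theta>\<close> close
to \<open>1\<close>; iterating shows \<open>v\<^sub>n \<longlonglongrightarrow> \<infinity>\<close>.\<close>

lemma negligible_increment:
  fixes p m :: "nat \<Rightarrow> real"
  assumes p: "\<forall>\<^sub>F n in sequentially. 0 < p n" and m: "\<forall>\<^sub>F n in sequentially. 0 \<le> m n"
    and \<kappa>: "0 < \<kappa>" and inc: "\<forall>\<^sub>F n in sequentially. m n + \<kappa> * p (Suc n) \<le> m (Suc n)"
    and slow: "\<And>\<theta>. 0 < \<theta> \<Longrightarrow> \<theta> < 1 \<Longrightarrow> \<forall>\<^sub>F n in sequentially. \<theta> * p (Suc n) \<le> p n"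
  shows "(\<lambda>n. p n / m n) \<longlonglongrightarrow> 0"
proof -
  have large: "\<forall>\<^sub>F n in sequentially. real j * (\<kappa> / 2) \<le> m n / p n" for j
  proof (induction j)
    case 0
    show ?case using p m by eventually_elim simp
  next
    case (Suc j)
    \<comment> \<open>A ratio below \<open>1\<close> for which \<open>\<kappa> + \<theta> a\<close> exceeds \<open>a = j \<kappa> / 2\<close> by at least \<open>\<kappa> / 2\<close>.\<close>
    define \<theta> where "\<theta> = (real j + 1) / (real j + 2)"
    have \<theta>: "0 < \<theta>" "\<theta> < 1" by (auto simp: \<theta>_def)
    have gain: "real (Suc j) * (\<kappa> / 2) \<le> \<kappa> + \<theta> * (real j * (\<kappa> / 2))"
    proof -
      have "real (Suc j) \<le> 2 + \<theta> * real j" by (simp add: \<theta>_def field_simps)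
      then have "real (Suc j) * (\<kappa> / 2) \<le> (2 + \<theta> * real j) * (\<kappa> / 2)"
        using \<kappa> by (intro mult_right_mono) auto
      then show ?thesis by (simp add: field_simps)
    qed
    have p_Suc: "\<forall>\<^sub>F n in sequentially. 0 < p (Suc n)"
      using p by (rule eventually_sequentially_Suc[THEN iffD2])
    have "\<forall>\<^sub>F n in sequentially. real (Suc j) * (\<kappa> / 2) \<le> m (Suc n) / p (Suc n)"
      using Suc p p_Suc inc slow[OF \<theta>]
    proof eventually_elim
      case (elim n)
      have "real j * (\<kappa> / 2) * (\<theta> * p (Suc n)) \<le> real j * (\<kappa> / 2) * p n"
        using elim \<kappa> by (intro mult_left_mono) auto
      also have "\<dots> \<le> m n" using elim by (simp add: pos_le_divide_eq)
      finally have "(\<kappa> + \<theta> * (real j * (\<kappa> / 2))) * p (Suc n) \<le> m (Suc n)"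
        using elim by (simp add: algebra_simps)
      then have "\<kappa> + \<theta> * (real j * (\<kappa> / 2)) \<le> m (Suc n) / p (Suc n)"
        using elim by (simp add: pos_le_divide_eq)
      then show ?case using gain by linarith
    qed
    then show ?case by (rule eventually_sequentially_Suc[THEN iffD1])
  qed
  have "filterlim (\<lambda>n. m n / p n) at_top sequentially"
    unfolding filterlim_at_top
  proof
    fix C :: real
    obtain j :: nat where "C / (\<kappa> / 2) \<le> real j" using real_arch_simple by blast
    then have "C \<le> real j * (\<kappa> / 2)" using \<kappa> by (simp add: field_simps)
    then show "\<forall>\<^sub>F n in sequentially. C \<le> m n / p n"
      by (intro eventually_mono[OF large[of j]]) (rule order_trans)
  qed
  then have "(\<lambda>n. inverse (m n / p n)) \<longlonglongrightarrow> 0" by (rule tendsto_inverse_0_at_top)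
  then show ?thesis by (simp add: field_simps)
qed

section \<open>The reciprocal of the generalised inverse of the norming function\<close>

text \<open>This is \<open>\<ell>(x) / x\<close>. Substituting \<open>u = 1 / t\<close> shows that it is the reciprocal of the generalised inverse
\<open>inf {u \<ge> 1. A(u) > x}\<close> of \<open>A(u) = u \<ell>\<^sub>1(u)\<close>.\<close>

definition inverse_scale :: "(real \<Rightarrow> real) \<Rightarrow> real \<Rightarrow> real" where
  "inverse_scale l1 x = Sup {t \<in> {0<..1}. inverse t * l1 (1 / t) > x}"

lemma inverse_scale_upper:
  assumes "0 < t" "t \<le> 1" "x < inverse t * l1 (1 / t)"
  shows "t \<le> inverse_scale l1 x"
  unfolding inverse_scale_def by (rule cSup_upper) (use assms in auto)

lemma A_fun_unbounded_imp_nonempty: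
  assumes unbdd: "\<And>x. \<exists>u\<ge>1. x < A_fun l1 u"
  shows "{t \<in> {0<..1}. inverse t * l1 (1 / t) > x} \<noteq> {}"
proof -
  obtain u where "1 \<le> u" "x < A_fun l1 u" using unbdd by blast
  then have "1 / u \<in> {t \<in> {0<..1}. inverse t * l1 (1 / t) > x}" by (simp add: A_fun_def)
  then show ?thesis by blast
qed

lemma inverse_scale_pos:
  assumes unbdd: "\<And>x. \<exists>u\<ge>1. x < A_fun l1 u"
  shows "0 < inverse_scale l1 x"
  using A_fun_unbounded_imp_nonempty[OF unbdd, of x] inverse_scale_upper[of _ x l1]
  by (force intro: less_le_trans)

lemma inverse_scale_antimono:
  assumes unbdd: "\<And>x. \<exists>u\<ge>1. x < A_fun l1 u" and "x \<le> y"
  shows "inverse_scale l1 y \<le> inverse_scale l1 x"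
  unfolding inverse_scale_def
  by (rule cSup_subset_mono[OF A_fun_unbounded_imp_nonempty[OF unbdd]])
     (use \<open>x \<le> y\<close> in \<open>auto intro!: bdd_aboveI[of _ 1]\<close>)

text \<open>One half of the regular variation of index \<open>-1\<close>. If \<open>A(u) > \<rho> x\<close> with \<open>u\<close> large, slow variation of
\<open>\<ell>\<^sub>1\<close> at the single ratio \<open>r = 1 / (\<eta> \<rho>)\<close> gives \<open>A(r u) \<ge> \<eta> r A(u) > x\<close>, so every candidate \<open>1 / u\<close> in
the supremum at \<open>\<rho> x\<close> yields the candidate \<open>\<eta> \<rho> / u\<close> at \<open>x\<close>. Only candidates with large \<open>u\<close> occur for
large \<open>x\<close>, because the supremum is assumed to tend to \<open>0\<close>.\<close>

lemma inverse_scale_decay: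
  assumes l1: "slowly_varying 1 l1"
    and unbdd: "\<And>x. \<exists>u\<ge>1. x < A_fun l1 u"
    and lim: "(inverse_scale l1 \<longlongrightarrow> 0) at_top"
    and \<eta>: "0 < \<eta>" "\<eta> < 1" and \<rho>: "0 < \<rho>"
  shows "\<forall>\<^sub>F x in at_top. \<eta> * \<rho> * inverse_scale l1 (\<rho> * x) \<le> inverse_scale l1 x"
proof -
  define r where "r = 1 / (\<eta> * \<rho>)"
  have r: "0 < r" using \<eta> \<rho> by (simp add: r_def)
  have "((\<lambda>u. l1 (r * u) / l1 u) \<longlongrightarrow> 1) at_top" using l1 r by (simp add: slowly_varying_def)
  then have "\<forall>\<^sub>F u in at_top. \<eta> < l1 (r * u) / l1 u" by (rule order_tendstoD(1)) (rule \<eta>(2))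
  then obtain U0 where U0: "\<And>u. U0 \<le> u \<Longrightarrow> \<eta> < l1 (r * u) / l1 u"
    unfolding eventually_at_top_linorder by blast
  define U where "U = Max {1, \<eta> * \<rho>, U0}"
  have U: "1 \<le> U" "\<eta> * \<rho> \<le> U" "U0 \<le> U" by (auto simp: U_def)
  have sc: "filterlim (\<lambda>x. \<rho> * x) at_top at_top"
    using \<rho> by (intro filterlim_tendsto_pos_mult_at_top[OF tendsto_const]) (auto simp: filterlim_ident)
  have "\<forall>\<^sub>F x in at_top. inverse_scale l1 (\<rho> * x) < 1 / U"
    using filterlim_compose[OF lim sc] U by (intro order_tendstoD(2)) auto
  then show ?thesis
    using eventually_gt_at_top[of 0]
  proof eventually_elim
    case (elim x)
    have "t \<le> inverse_scale l1 x / (\<eta> * \<rho>)"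
      if t: "t \<in> {t \<in> {0<..1}. inverse t * l1 (1 / t) > \<rho> * x}" for t
    proof -
      define u where "u = 1 / t"
      have "t \<le> inverse_scale l1 (\<rho> * x)" using t by (intro inverse_scale_upper) auto
      then have "t < 1 / U" using elim by simp
      then have u: "U < u" using t U by (simp add: u_def field_simps)
      then have "l1 u > 0" using U l1 by (simp add: slowly_varying_def)
      then have "\<eta> * l1 u < l1 (r * u)" using U0[of u] u U by (simp add: field_simps)
      then have "r * u * (\<eta> * l1 u) < r * u * l1 (r * u)" using r u U by simp
      moreover have "r * u * (\<eta> * l1 u) = u * l1 u / \<rho>" using \<eta> by (simp add: r_def)
      moreover have "\<rho> * x < u * l1 u" using t by (simp add: u_def inverse_eq_divide)
      then have "x < u * l1 u / \<rho>" using \<rho> by (simp add: pos_less_divide_eq mult.commute)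
      ultimately have "x < r * u * l1 (r * u)" by simp
      moreover have "1 \<le> r * u" using U u \<eta> \<rho> by (simp add: r_def field_simps)
      ultimately have "1 / (r * u) \<le> inverse_scale l1 x"
        using r u U by (intro inverse_scale_upper) (auto simp: field_simps)
      then show ?thesis using \<eta> \<rho> by (simp add: r_def u_def field_simps)
    qed
    then have "inverse_scale l1 (\<rho> * x) \<le> inverse_scale l1 x / (\<eta> * \<rho>)"
      unfolding inverse_scale_def[of l1 "\<rho> * x"]
      by (intro cSup_least A_fun_unbounded_imp_nonempty[OF unbdd])
    then show ?case using \<eta> \<rho> by (simp add: field_simps)
  qed
qed

section \<open>Truncated means and the renewal function\<close>

definition truncated_mean :: "real measure \<Rightarrow> real \<Rightarrow> real" where
  "truncated_mean \<mu> v = (\<integral>x. min x v \<partial>\<mu>)"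

locale nonneg_law = real_distribution \<mu> for \<mu> :: "real measure" +
  assumes nonneg: "AE x in \<mu>. 0 \<le> x"

context nonneg_law
begin

lemma tail_eq: "measure \<mu> {x<..} = 1 - cdf \<mu> x"
proof -
  have "measure \<mu> (space \<mu> - {..x}) = 1 - measure \<mu> {..x}"
    by (intro prob_compl) auto
  moreover have "space \<mu> - {..x} = {x<..}" by auto
  ultimately show ?thesis by (simp add: cdf_def)
qed

lemma integrable_scaled_indicator:
  assumes "A \<in> sets borel" shows "integrable \<mu> (\<lambda>x. a * indicator A x :: real)"
  by (rule integrable_const_bound[where B = "\<bar>a\<bar>"]) (use assms in \<open>auto simp: indicator_def\<close>)

lemma integrable_truncation: "0 \<le> v \<Longrightarrow> integrable \<mu> (\<lambda>x. min x v)"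
  by (rule integrable_const_bound[where B = v]) (use nonneg in \<open>auto elim!: eventually_mono\<close>)

lemma truncated_mean_mono:
  assumes "0 \<le> u" "u \<le> v" shows "truncated_mean \<mu> u \<le> truncated_mean \<mu> v"
  unfolding truncated_mean_def using assms
  by (intro integral_mono integrable_truncation) auto

lemma truncated_mean_nonneg: "0 \<le> v \<Longrightarrow> 0 \<le> truncated_mean \<mu> v"
  unfolding truncated_mean_def by (intro integral_nonneg_AE) (use nonneg in \<open>auto elim!: eventually_mono\<close>)

lemma truncated_mean_increment_le:
  assumes "0 \<le> u" "u \<le> v"
  shows "truncated_mean \<mu> v - truncated_mean \<mu> u \<le> (v - u) * (1 - cdf \<mu> u)"
proof -
  have "truncated_mean \<mu> v - truncated_mean \<mu> u = (\<integral>x. min x v - min x u \<partial>\<mu>)"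
    unfolding truncated_mean_def using assms by (simp add: integrable_truncation)
  also have "\<dots> \<le> (\<integral>x. (v - u) * indicator {u<..} x \<partial>\<mu>)"
    using assms by (intro integral_mono Bochner_Integration.integrable_diff integrable_truncation
        integrable_scaled_indicator)
      (auto simp: indicator_def)
  also have "\<dots> = (v - u) * (1 - cdf \<mu> u)" by (simp add: tail_eq)
  finally show ?thesis .
qed

lemma truncated_mean_increment_ge:
  assumes "0 \<le> u" "u \<le> v"
  shows "(v - u) * (1 - cdf \<mu> v) \<le> truncated_mean \<mu> v - truncated_mean \<mu> u"
proof -
  have "(v - u) * (1 - cdf \<mu> v) = (\<integral>x. (v - u) * indicator {v<..} x \<partial>\<mu>)"
    by (simp add: tail_eq)
  also have "\<dots> \<le> (\<integral>x. min x v - min x u \<partial>\<mu>)"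
    using assms by (intro integral_mono Bochner_Integration.integrable_diff integrable_truncation
        integrable_scaled_indicator)
      (auto simp: indicator_def)
  also have "\<dots> = truncated_mean \<mu> v - truncated_mean \<mu> u"
    unfolding truncated_mean_def using assms by (simp add: integrable_truncation)
  finally show ?thesis .
qed

lemma measurable_truncated_mean: "(\<lambda>s. truncated_mean \<mu> (max 0 (y - s))) \<in> borel_measurable borel"
proof -
  have "mono (\<lambda>v. truncated_mean \<mu> (max 0 v))"
    by (auto intro!: monoI truncated_mean_mono)
  then have [measurable]: "(\<lambda>v. truncated_mean \<mu> (max 0 v)) \<in> borel_measurable borel"
    by (rule borel_measurable_mono)
  show ?thesis by measurable
qed

lemma nonneg_law_conv_power: "nonneg_law (conv_power \<mu> n)"
proof (induction n)
  case 0
  have "prob_space (return borel (0::real))" by (rule prob_space_return) simp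
  then show ?case
    by (simp add: nonneg_law_def nonneg_law_axioms_def real_distribution_def
        real_distribution_axioms_def AE_return)
next
  case (Suc n)
  then interpret N: nonneg_law "conv_power \<mu> n" .
  interpret P: pair_prob_space \<mu> "conv_power \<mu> n" ..
  have add: "(\<lambda>(x, y). x + y) \<in> \<mu> \<Otimes>\<^sub>M conv_power \<mu> n \<rightarrow>\<^sub>M (borel :: real measure)"
    by measurable
  have "AE z in \<mu> \<Otimes>\<^sub>M conv_power \<mu> n. 0 \<le> (case z of (x, y) \<Rightarrow> x + y)"
  proof -
    have "AE x in \<mu>. AE y in conv_power \<mu> n. 0 \<le> x + y"
      using nonneg by eventually_elim (use N.nonneg in \<open>auto elim!: eventually_mono\<close>)
    then have "AE x in \<mu>. AE y in conv_power \<mu> n. 0 \<le> (case (x, y) of (x, y) \<Rightarrow> x + y)"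
      by simp
    moreover have "{z \<in> space (\<mu> \<Otimes>\<^sub>M conv_power \<mu> n). 0 \<le> (case z of (x, y) \<Rightarrow> x + y)}
        \<in> sets (\<mu> \<Otimes>\<^sub>M conv_power \<mu> n)"
      by measurable
    ultimately show ?thesis
      by (intro P.AE_pair_measure)
  qed
  then have "AE x in conv_power \<mu> (Suc n). 0 \<le> x"
    unfolding conv_power.simps convolution_def by (subst AE_distr_iff[OF add]) auto
  moreover have "real_distribution (conv_power \<mu> (Suc n))"
    using P.real_distribution_distr[OF add] by (simp add: convolution_def)
  ultimately show ?case unfolding nonneg_law_def nonneg_law_axioms_def by blast
qed

text \<open>The mean of \<open>(y - S\<^sub>n)\<^sup>+\<close>, the part of the interval \<open>[0, y]\<close> that the walk has not yet covered after
\<open>n\<close> steps.\<close>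

definition remainder_mean :: "nat \<Rightarrow> real \<Rightarrow> real" where
  "remainder_mean n y = (\<integral>s. max 0 (y - s) \<partial>conv_power \<mu> n)"

lemma integrable_remainder:
  assumes "0 \<le> y" shows "integrable \<mu> (\<lambda>s. max 0 (y - s))"
  using assms by (intro integrable_const_bound[where B = y]) (use nonneg in \<open>auto elim!: eventually_mono\<close>)

text \<open>For \<open>x \<ge> 0\<close> the numbers \<open>(w - x)\<^sup>+\<close> and \<open>min x w\<^sup>+\<close> add up to \<open>w\<^sup>+\<close>. Integrating nonnegative
extended reals avoids integrability conditions on \<open>w\<close> when this is integrated once more over the
position of the walk.\<close>

lemma remainder_one_step:
  "(\<integral>\<^sup>+x. ennreal (max 0 (w - x)) \<partial>\<mu>) + ennreal (truncated_mean \<mu> (max 0 w)) = ennreal (max 0 w)"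
proof -
  have "(\<integral>\<^sup>+x. ennreal (max 0 (w - x)) \<partial>\<mu>) + ennreal (truncated_mean \<mu> (max 0 w))
    = (\<integral>\<^sup>+x. ennreal (max 0 (w - x)) \<partial>\<mu>) + (\<integral>\<^sup>+x. ennreal (min x (max 0 w)) \<partial>\<mu>)"
    unfolding truncated_mean_def
    by (subst nn_integral_eq_integral) (use nonneg in \<open>auto intro!: integrable_truncation elim!: eventually_mono\<close>)
  also have "\<dots> = (\<integral>\<^sup>+x. ennreal (max 0 (w - x)) + ennreal (min x (max 0 w)) \<partial>\<mu>)"
    by (subst nn_integral_add) auto
  also have "\<dots> = (\<integral>\<^sup>+x. ennreal (max 0 w) \<partial>\<mu>)"
  proof (rule nn_integral_cong_AE)
    show "AE x in \<mu>. ennreal (max 0 (w - x)) + ennreal (min x (max 0 w)) = ennreal (max 0 w)"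
      using nonneg by eventually_elim (auto simp: max_def min_def simp flip: ennreal_plus)
  qed
  also have "\<dots> = ennreal (max 0 w)" by (simp add: emeasure_space_1[unfolded space_eq_univ])
  finally show ?thesis .
qed

lemma truncated_mean_shift_integrable:
  assumes "0 \<le> y"
  shows "integrable (conv_power \<mu> n) (\<lambda>s. truncated_mean \<mu> (max 0 (y - s)))"
proof -
  interpret N: nonneg_law "conv_power \<mu> n" by (rule nonneg_law_conv_power)
  have "AE s in conv_power \<mu> n. norm (truncated_mean \<mu> (max 0 (y - s))) \<le> truncated_mean \<mu> y"
    using N.nonneg
  proof eventually_elim
    case (elim s)
    then show ?case
      using assms truncated_mean_nonneg[of "max 0 (y - s)"] truncated_mean_mono[of "max 0 (y - s)" y]
      by auto
  qed
  then show ?thesis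
    by (rule N.integrable_const_bound)
       (use measurable_truncated_mean in \<open>simp add: measurable_cong_sets[OF N.events_eq_borel refl]\<close>)
qed

text \<open>Conditioning on \<open>S\<^sub>n = s\<close> and applying the one-step identity with \<open>w = y - s\<close>. The recursion for
\<open>conv_power\<close> adds the new step on the left, so the factors are exchanged by commutativity of
convolution.\<close>

lemma remainder_mean_Suc:
  assumes y: "0 \<le> y"
  shows "remainder_mean n y - remainder_mean (Suc n) y
      = (\<integral>s. truncated_mean \<mu> (max 0 (y - s)) \<partial>conv_power \<mu> n)"
proof -
  let ?\<nu> = "conv_power \<mu> n"
  interpret N: nonneg_law ?\<nu> by (rule nonneg_law_conv_power)
  interpret S: nonneg_law "conv_power \<mu> (Suc n)" by (rule nonneg_law_conv_power)
  note [measurable] = measurable_truncated_mean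
  have fin: "finite_measure \<mu>" "finite_measure ?\<nu>" by unfold_locales
  have inner [measurable]: "(\<lambda>s. \<integral>\<^sup>+x. ennreal (max 0 (y - s - x)) \<partial>\<mu>) \<in> borel_measurable borel"
    by measurable
  have "(\<integral>\<^sup>+t. ennreal (max 0 (y - t)) \<partial>conv_power \<mu> (Suc n))
      = (\<integral>\<^sup>+t. ennreal (max 0 (y - t)) \<partial>convolution ?\<nu> \<mu>)"
    using convolution_commutative[OF fin] by simp
  also have "\<dots> = (\<integral>\<^sup>+s. \<integral>\<^sup>+x. ennreal (max 0 (y - s - x)) \<partial>\<mu> \<partial>?\<nu>)"
    by (subst nn_integral_convolution) (use fin in \<open>auto simp: algebra_simps\<close>)
  finally have conv: "(\<integral>\<^sup>+t. ennreal (max 0 (y - t)) \<partial>conv_power \<mu> (Suc n))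
      = (\<integral>\<^sup>+s. \<integral>\<^sup>+x. ennreal (max 0 (y - s - x)) \<partial>\<mu> \<partial>?\<nu>)" .
  have "(\<integral>\<^sup>+t. ennreal (max 0 (y - t)) \<partial>conv_power \<mu> (Suc n))
      + (\<integral>\<^sup>+s. ennreal (truncated_mean \<mu> (max 0 (y - s))) \<partial>?\<nu>)
      = (\<integral>\<^sup>+s. ennreal (max 0 (y - s)) \<partial>?\<nu>)"
    unfolding conv
    by (subst nn_integral_add[symmetric]) (auto simp: remainder_one_step simp del: ennreal_max_0 ennreal_max_0')
  moreover have "(\<integral>\<^sup>+t. ennreal (max 0 (y - t)) \<partial>conv_power \<mu> (Suc n)) = ennreal (remainder_mean (Suc n) y)"
    unfolding remainder_mean_def by (rule nn_integral_eq_integral[OF S.integrable_remainder[OF y]]) auto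
  moreover have "(\<integral>\<^sup>+s. ennreal (max 0 (y - s)) \<partial>?\<nu>) = ennreal (remainder_mean n y)"
    unfolding remainder_mean_def by (rule nn_integral_eq_integral[OF N.integrable_remainder[OF y]]) auto
  moreover have "(\<integral>\<^sup>+s. ennreal (truncated_mean \<mu> (max 0 (y - s))) \<partial>?\<nu>)
      = ennreal (\<integral>s. truncated_mean \<mu> (max 0 (y - s)) \<partial>?\<nu>)"
    by (rule nn_integral_eq_integral[OF truncated_mean_shift_integrable[OF y]])
       (auto intro!: truncated_mean_nonneg)
  moreover have "0 \<le> remainder_mean (Suc n) y" "0 \<le> remainder_mean n y"
      "0 \<le> (\<integral>s. truncated_mean \<mu> (max 0 (y - s)) \<partial>?\<nu>)"
    unfolding remainder_mean_def by (auto intro!: Bochner_Integration.integral_nonneg truncated_mean_nonneg)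
  ultimately show ?thesis by (simp flip: ennreal_plus)
qed

lemma remainder_mean_telescope:
  assumes "0 \<le> y"
  shows "(\<Sum>n<N. \<integral>s. truncated_mean \<mu> (max 0 (y - s)) \<partial>conv_power \<mu> n) = y - remainder_mean N y"
proof -
  have "remainder_mean 0 y = y"
    using assms by (simp add: remainder_mean_def integral_return)
  then show ?thesis
    using assms sum_lessThan_telescope'[of "\<lambda>n. remainder_mean n y" N] by (simp add: remainder_mean_Suc)
qed

text \<open>The integrand vanishes for \<open>s > y\<close> because \<open>m(0) = 0\<close>, and is at most \<open>m(y)\<close> for \<open>0 \<le> s \<le> y\<close>.\<close>

lemma truncated_mean_shift_le:
  assumes y: "0 \<le> y"
  shows "(\<integral>s. truncated_mean \<mu> (max 0 (y - s)) \<partial>conv_power \<mu> n) \<le> truncated_mean \<mu> y * cdf (conv_power \<mu> n) y"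
proof -
  interpret N: nonneg_law "conv_power \<mu> n" by (rule nonneg_law_conv_power)
  have "(\<integral>s. truncated_mean \<mu> (max 0 (y - s)) \<partial>conv_power \<mu> n)
      \<le> (\<integral>s. truncated_mean \<mu> y * indicator {..y} s \<partial>conv_power \<mu> n)"
  proof (rule integral_mono_AE[OF truncated_mean_shift_integrable[OF y]])
    have zero: "truncated_mean \<mu> 0 = 0"
      unfolding truncated_mean_def
      by (rule integral_eq_zero_AE) (use nonneg in \<open>auto elim!: eventually_mono\<close>)
    show "AE s in conv_power \<mu> n. truncated_mean \<mu> (max 0 (y - s)) \<le> truncated_mean \<mu> y * indicator {..y} s"
      using N.nonneg
      by eventually_elim (use zero in \<open>auto simp: indicator_def intro!: truncated_mean_mono\<close>)
  qed (rule N.integrable_scaled_indicator, simp)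
  then show ?thesis by (simp add: cdf_def)
qed

text \<open>On the event \<open>S\<^sub>n \<le> y\<close> the remaining distance to \<open>y + v\<close> is at least \<open>v\<close>.\<close>

lemma truncated_mean_shift_ge:
  assumes y: "0 \<le> y" and v: "0 \<le> v"
  shows "truncated_mean \<mu> v * cdf (conv_power \<mu> n) y
    \<le> (\<integral>s. truncated_mean \<mu> (max 0 (y + v - s)) \<partial>conv_power \<mu> n)"
proof -
  interpret N: nonneg_law "conv_power \<mu> n" by (rule nonneg_law_conv_power)
  have "(\<integral>s. truncated_mean \<mu> v * indicator {..y} s \<partial>conv_power \<mu> n)
     \<le> (\<integral>s. truncated_mean \<mu> (max 0 (y + v - s)) \<partial>conv_power \<mu> n)"
    by (rule integral_mono[OF N.integrable_scaled_indicator truncated_mean_shift_integrable])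
       (use assms in \<open>auto simp: indicator_def intro!: truncated_mean_mono truncated_mean_nonneg\<close>)
  then show ?thesis by (simp add: cdf_def)
qed

lemma partial_renewal_bound:
  assumes y: "0 \<le> y" and v: "0 \<le> v"
  shows "truncated_mean \<mu> v * (\<Sum>n<N. cdf (conv_power \<mu> n) y) \<le> y + v"
proof -
  have "truncated_mean \<mu> v * (\<Sum>n<N. cdf (conv_power \<mu> n) y)
      \<le> (\<Sum>n<N. \<integral>s. truncated_mean \<mu> (max 0 (y + v - s)) \<partial>conv_power \<mu> n)"
    unfolding sum_distrib_left by (intro sum_mono truncated_mean_shift_ge assms)
  also have "\<dots> = y + v - remainder_mean N (y + v)"
    using assms by (intro remainder_mean_telescope) auto
  also have "\<dots> \<le> y + v" by (simp add: remainder_mean_def)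
  finally show ?thesis .
qed

lemma cdf_conv_power_nonneg: "0 \<le> cdf (conv_power \<mu> n) y"
  by (simp add: cdf_def)

lemma summable_cdf_conv_power:
  assumes "0 \<le> y" "0 \<le> v" "0 < truncated_mean \<mu> v"
  shows "summable (\<lambda>n. cdf (conv_power \<mu> n) y)"
proof (rule bounded_imp_summable[OF cdf_conv_power_nonneg])
  fix n
  show "(\<Sum>i\<le>n. cdf (conv_power \<mu> i) y) \<le> (y + v) / truncated_mean \<mu> v"
    using partial_renewal_bound[OF assms(1,2), of "Suc n"] assms(3)
    by (simp only: lessThan_Suc_atMost pos_le_divide_eq mult.commute)
qed

lemma renewal_function_upper:
  assumes "0 \<le> y" "0 \<le> v" "0 < truncated_mean \<mu> v"
  shows "truncated_mean \<mu> v * renewal_function \<mu> y \<le> y + v"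
proof -
  have "renewal_function \<mu> y \<le> (y + v) / truncated_mean \<mu> v"
    unfolding renewal_function_def
    by (rule suminf_le_const[OF summable_cdf_conv_power[OF assms]])
       (use partial_renewal_bound[OF assms(1,2)] assms(3) in \<open>simp add: field_simps\<close>)
  then show ?thesis using assms(3) by (simp add: field_simps)
qed

text \<open>The remainder after \<open>N\<close> steps is at most \<open>y P(S\<^sub>N \<le> y)\<close>. This tends to \<open>0\<close> because the renewal series
converges, so the losses \<open>m((y - S\<^sub>n)\<^sup>+)\<close> add up in the mean to all of \<open>y\<close>.\<close>

lemma renewal_function_lower:
  assumes y: "0 \<le> y" and pos: "0 < truncated_mean \<mu> y"
  shows "y \<le> truncated_mean \<mu> y * renewal_function \<mu> y"
proof -
  have sm: "summable (\<lambda>n. cdf (conv_power \<mu> n) y)"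
    using summable_cdf_conv_power[OF y y pos] .
  have rem: "remainder_mean N y \<le> y * cdf (conv_power \<mu> N) y" for N
  proof -
    interpret N: nonneg_law "conv_power \<mu> N" by (rule nonneg_law_conv_power)
    have "remainder_mean N y \<le> (\<integral>s. y * indicator {..y} s \<partial>conv_power \<mu> N)"
      unfolding remainder_mean_def
    proof (rule integral_mono_AE[OF N.integrable_remainder[OF y]])
      show "AE s in conv_power \<mu> N. max 0 (y - s) \<le> y * indicator {..y} s"
        using N.nonneg by eventually_elim (auto simp: indicator_def)
    qed (rule N.integrable_scaled_indicator, simp)
    then show ?thesis by (simp add: cdf_def)
  qed
  have "y - y * cdf (conv_power \<mu> N) y \<le> truncated_mean \<mu> y * renewal_function \<mu> y" for N
  proof -
    have "y - y * cdf (conv_power \<mu> N) y \<le> y - remainder_mean N y" using rem[of N] by simp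
    also have "\<dots> \<le> truncated_mean \<mu> y * (\<Sum>n<N. cdf (conv_power \<mu> n) y)"
      unfolding remainder_mean_telescope[OF y, symmetric] sum_distrib_left
      by (intro sum_mono truncated_mean_shift_le y)
    also have "\<dots> \<le> truncated_mean \<mu> y * renewal_function \<mu> y"
      unfolding renewal_function_def
      by (intro mult_left_mono sum_le_suminf sm) (use pos cdf_conv_power_nonneg in auto)
    finally show ?thesis .
  qed
  moreover have "(\<lambda>N. y - y * cdf (conv_power \<mu> N) y) \<longlonglongrightarrow> y - y * 0"
    by (intro tendsto_intros summable_LIMSEQ_zero sm)
  ultimately show ?thesis
    using LIMSEQ_le_const2 by fastforce
qed

text \<open>The two bounds squeeze \<open>U(y) m(y) / y\<close> between \<open>1\<close> and \<open>(1 + \<epsilon>) m(y) / m(\<epsilon> y)\<close>.\<close>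

theorem renewal_function_asymp_truncated_mean:
  assumes sv: "\<And>\<epsilon>. 0 < \<epsilon> \<Longrightarrow> \<epsilon> < 1 \<Longrightarrow>
      ((\<lambda>y. truncated_mean \<mu> (\<epsilon> * y) / truncated_mean \<mu> y) \<longlongrightarrow> 1) at_top"
    and pos: "\<forall>\<^sub>F y in at_top. 0 < truncated_mean \<mu> y"
  shows "((\<lambda>y. renewal_function \<mu> y * truncated_mean \<mu> y / y) \<longlongrightarrow> 1) at_top"
proof (rule order_tendstoI)
  fix a :: real assume "a < 1"
  show "\<forall>\<^sub>F y in at_top. a < renewal_function \<mu> y * truncated_mean \<mu> y / y"
    using pos eventually_gt_at_top[of 0]
  proof eventually_elim
    case (elim y)
    then show ?case
      using renewal_function_lower[of y] \<open>a < 1\<close>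
      by (intro less_le_trans[OF \<open>a < 1\<close>]) (auto simp: field_simps)
  qed
next
  fix a :: real assume a: "1 < a"
  define \<epsilon> where "\<epsilon> = min (1/2) ((a - 1) / 2)"
  have \<epsilon>: "0 < \<epsilon>" "\<epsilon> < 1" "1 + \<epsilon> < a" using a by (auto simp: \<epsilon>_def min_def field_simps)
  have "filterlim (\<lambda>y. \<epsilon> * y) at_top at_top"
    using \<epsilon> by (intro filterlim_tendsto_pos_mult_at_top[OF tendsto_const]) (auto simp: filterlim_ident)
  then have pos': "\<forall>\<^sub>F y in at_top. 0 < truncated_mean \<mu> (\<epsilon> * y)"
    using pos by (rule eventually_compose_filterlim[rotated])
  have "\<forall>\<^sub>F y in at_top. (1 + \<epsilon>) / a < truncated_mean \<mu> (\<epsilon> * y) / truncated_mean \<mu> y"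
    by (rule order_tendstoD(1)[OF sv]) (use \<epsilon> a in auto)
  then show "\<forall>\<^sub>F y in at_top. renewal_function \<mu> y * truncated_mean \<mu> y / y < a"
    using pos pos' eventually_gt_at_top[of 0]
  proof eventually_elim
    case (elim y)
    let ?U = "renewal_function \<mu> y" and ?m = "truncated_mean \<mu> y" and ?e = "truncated_mean \<mu> (\<epsilon> * y)"
    have "?e * ?U \<le> (1 + \<epsilon>) * y"
      using renewal_function_upper[of y "\<epsilon> * y"] elim \<epsilon> by (simp add: algebra_simps)
    moreover have "(1 + \<epsilon>) * ?m < a * ?e" using elim a by (simp add: field_simps)
    moreover have U: "0 < ?U"
      using renewal_function_lower[of y] elim by (smt (verit) mult_nonneg_nonpos)
    ultimately have "(1 + \<epsilon>) * ?m * ?U < (1 + \<epsilon>) * (a * y)"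
    proof -
      have "(1 + \<epsilon>) * ?m * ?U < a * ?e * ?U"
        using \<open>(1 + \<epsilon>) * ?m < a * ?e\<close> U by simp
      also have "\<dots> = a * (?e * ?U)" by simp
      also have "\<dots> \<le> a * ((1 + \<epsilon>) * y)"
        using \<open>?e * ?U \<le> (1 + \<epsilon>) * y\<close> a by (intro mult_left_mono) auto
      finally show ?thesis by (simp add: algebra_simps)
    qed
    then have "?m * ?U < a * y" using \<epsilon> by (simp add: mult.assoc)
    then show ?case using elim by (simp add: field_simps)
  qed
qed

text \<open>Fubini's theorem for the region \<open>{(u, x). a \<le> u \<le> b \<and> u < x}\<close>.\<close>

lemma integral_tail_eq_truncated_mean_diff:
  assumes a: "0 \<le> a" and ab: "a \<le> b"
  shows "integral {a..b} (\<lambda>u. 1 - cdf \<mu> u) = truncated_mean \<mu> b - truncated_mean \<mu> a"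
proof -
  interpret L: sigma_finite_measure "lborel :: real measure" by (rule lborel.sigma_finite_measure_axioms)
  interpret P: pair_sigma_finite "lborel :: real measure" \<mu> ..
  have "mono (cdf \<mu>)" by (auto intro: monoI cdf_nondecreasing)
  then have [measurable]: "cdf \<mu> \<in> borel_measurable borel" by (rule borel_measurable_mono)
  let ?f = "\<lambda>u. indicator {a..b} u * (1 - cdf \<mu> u)"
  have slice: "(\<integral>\<^sup>+u. indicator {a..b} u * indicator {..<x} u \<partial>lborel) = ennreal (min x b - min x a)" for x
  proof -
    have "(\<integral>\<^sup>+u. indicator {a..b} u * indicator {..<x} u \<partial>lborel)
        = (\<integral>\<^sup>+u. indicator ({a..b} \<inter> {..<x}) u \<partial>lborel)"
      by (simp add: indicator_inter_arith)
    also have "\<dots> = emeasure lborel ({a..b} \<inter> {..<x})" by simp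
    also have "\<dots> = ennreal (min x b - min x a)"
    proof -
      consider "x \<le> a" | "a < x" "x \<le> b" | "b < x" by linarith
      then show ?thesis
      proof cases
        case 1 then have "{a..b} \<inter> {..<x} = {}" by auto
        then show ?thesis using 1 ab by simp
      next
        case 2 then have "{a..b} \<inter> {..<x} = {a..<x}" by auto
        then show ?thesis using 2 by simp
      next
        case 3 then have "{a..b} \<inter> {..<x} = {a..b}" by auto
        then show ?thesis using 3 ab by simp
      qed
    qed
    finally show ?thesis .
  qed
  have "(\<integral>\<^sup>+u. ennreal (?f u) \<partial>lborel)
      = (\<integral>\<^sup>+u. \<integral>\<^sup>+x. indicator {a..b} u * indicator {..<x} u \<partial>\<mu> \<partial>lborel)"
  proof (rule nn_integral_cong)
    fix u
    have "(\<integral>\<^sup>+x. indicator {a..b} u * indicator {..<x} u \<partial>\<mu>)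
        = (\<integral>\<^sup>+x. indicator {a..b} u * indicator {u<..} x \<partial>\<mu>)"
      by (intro nn_integral_cong) (auto simp: indicator_def)
    also have "\<dots> = indicator {a..b} u * emeasure \<mu> {u<..}"
      by (subst nn_integral_cmult) auto
    also have "\<dots> = ennreal (?f u)"
      by (auto simp: indicator_def emeasure_eq_measure tail_eq)
    finally show "ennreal (?f u) = (\<integral>\<^sup>+x. indicator {a..b} u * indicator {..<x} u \<partial>\<mu>)" by simp
  qed
  also have "\<dots> = (\<integral>\<^sup>+x. \<integral>\<^sup>+u. indicator {a..b} u * indicator {..<x} u \<partial>lborel \<partial>\<mu>)"
    by (rule P.Fubini'[symmetric]) (simp add: indicator_def[abs_def])
  also have "\<dots> = (\<integral>\<^sup>+x. ennreal (min x b - min x a) \<partial>\<mu>)" by (simp add: slice)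
  also have "\<dots> = ennreal (\<integral>x. min x b - min x a \<partial>\<mu>)"
    using a ab by (intro nn_integral_eq_integral Bochner_Integration.integrable_diff integrable_truncation) auto
  also have "(\<integral>x. min x b - min x a \<partial>\<mu>) = truncated_mean \<mu> b - truncated_mean \<mu> a"
    unfolding truncated_mean_def using a ab by (simp add: integrable_truncation)
  finally have "(?f has_integral (truncated_mean \<mu> b - truncated_mean \<mu> a)) UNIV"
    using truncated_mean_mono[OF a ab] cdf_bounded_prob
    by (intro nn_integral_has_integral) auto
  moreover have "?f = (\<lambda>u. if u \<in> {a..b} then 1 - cdf \<mu> u else 0)"
    by (auto simp: indicator_def)
  ultimately show ?thesis
    by (intro integral_unique) (simp only: has_integral_restrict_UNIV)
qed

lemma truncated_mean_at_top:
  assumes inf: "(\<integral>\<^sup>+x. ennreal x \<partial>\<mu>) = \<infinity>"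
  shows "filterlim (truncated_mean \<mu>) at_top at_top"
proof -
  define a where "a n = truncated_mean \<mu> (real n)" for n
  have inc: "incseq a"
    by (auto simp: a_def intro!: incseq_SucI truncated_mean_mono)
  have "\<exists>n. C \<le> a n" for C
  proof (rule ccontr)
    assume "\<not> (\<exists>n. C \<le> a n)"
    then have "\<And>n. a n \<le> C" by (auto simp: not_le intro: less_imp_le)
    then obtain l where l: "a \<longlonglongrightarrow> l" using incseq_convergent[OF inc] by metis
    have "integrable \<mu> (\<lambda>x. x)"
    proof (rule integrable_monotone_convergence[where f = "\<lambda>n x. min x (real n)"])
      show "AE x in \<mu>. (\<lambda>n. min x (real n)) \<longlonglongrightarrow> x"
      proof (rule AE_I2)
        fix x :: real
        obtain n :: nat where n: "x \<le> real n" using real_arch_simple by blast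
        have "\<forall>\<^sub>F m in sequentially. min x (real m) = x"
          using eventually_ge_at_top[of n] by eventually_elim (use n in auto)
        then show "(\<lambda>n. min x (real n)) \<longlonglongrightarrow> x" by (rule tendsto_eventually)
      qed
      show "(\<lambda>n. \<integral>x. min x (real n) \<partial>\<mu>) \<longlonglongrightarrow> l" using l by (simp add: a_def[abs_def] truncated_mean_def)
    qed (auto intro!: integrable_truncation monoI)
    then have "(\<integral>\<^sup>+x. ennreal x \<partial>\<mu>) = ennreal (\<integral>x. x \<partial>\<mu>)"
      by (rule nn_integral_eq_integral) (rule nonneg)
    then show False using inf by simp
  qed
  then have *: "\<exists>n. C \<le> truncated_mean \<mu> (real n)" for C by (simp add: a_def)
  show ?thesis unfolding filterlim_at_top
  proof
    fix C
    obtain n where n: "C \<le> truncated_mean \<mu> (real n)" using * by blast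
    show "\<forall>\<^sub>F x in at_top. C \<le> truncated_mean \<mu> x"
      using eventually_ge_at_top[of "real n"]
      by eventually_elim (rule order_trans[OF n truncated_mean_mono], auto)
  qed
qed

text \<open>The increment of \<open>m\<close> from \<open>\<epsilon> y\<close> to \<open>y\<close> is at most \<open>y (1 - F(\<epsilon> y))\<close>, which is \<open>1 / \<epsilon>\<close> times the
quantity assumed to be negligible against \<open>m(\<epsilon> y) \<le> m(y)\<close>.\<close>

lemma truncated_mean_slowly_varying:
  assumes lim: "((\<lambda>x. x * (1 - cdf \<mu> x) / truncated_mean \<mu> x) \<longlongrightarrow> 0) at_top"
    and inf: "filterlim (truncated_mean \<mu>) at_top at_top"
    and \<epsilon>: "0 < \<epsilon>" "\<epsilon> < 1"
  shows "((\<lambda>y. truncated_mean \<mu> (\<epsilon> * y) / truncated_mean \<mu> y) \<longlongrightarrow> 1) at_top"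
proof (rule real_tendsto_sandwich)
  let ?m = "truncated_mean \<mu>"
  let ?q = "\<lambda>x. x * (1 - cdf \<mu> x) / ?m x"
  have sc: "filterlim (\<lambda>y. \<epsilon> * y) at_top at_top"
    using \<epsilon> by (intro filterlim_tendsto_pos_mult_at_top[OF tendsto_const]) (auto simp: filterlim_ident)
  have pos: "\<forall>\<^sub>F y in at_top. 0 < ?m y" using inf by (simp add: filterlim_at_top_dense)
  have pos': "\<forall>\<^sub>F y in at_top. 0 < ?m (\<epsilon> * y)"
    by (rule eventually_compose_filterlim[OF pos sc])
  have "((\<lambda>y. 1 - ?q (\<epsilon> * y) / \<epsilon>) \<longlongrightarrow> 1 - 0 / \<epsilon>) at_top"
    by (intro tendsto_intros filterlim_compose[OF lim sc]) (use \<epsilon> in auto)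
  then show "((\<lambda>y. 1 - ?q (\<epsilon> * y) / \<epsilon>) \<longlongrightarrow> 1) at_top" by simp
  show "\<forall>\<^sub>F y in at_top. 1 - ?q (\<epsilon> * y) / \<epsilon> \<le> ?m (\<epsilon> * y) / ?m y"
    using pos pos' eventually_gt_at_top[of 0]
  proof eventually_elim
    case (elim y)
    have T: "0 \<le> 1 - cdf \<mu> (\<epsilon> * y)" using cdf_bounded_prob[of "\<epsilon> * y"] by simp
    have le: "?m (\<epsilon> * y) \<le> ?m y" using elim \<epsilon> by (intro truncated_mean_mono) auto
    have "?m y - ?m (\<epsilon> * y) \<le> (y - \<epsilon> * y) * (1 - cdf \<mu> (\<epsilon> * y))"
      using elim \<epsilon> by (intro truncated_mean_increment_le) auto
    also have "\<dots> \<le> y * (1 - cdf \<mu> (\<epsilon> * y))"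
      using T elim \<epsilon> by (intro mult_right_mono) auto
    finally have "(?m y - ?m (\<epsilon> * y)) / ?m y \<le> y * (1 - cdf \<mu> (\<epsilon> * y)) / ?m y"
      using elim by (intro divide_right_mono) auto
    then have "1 - ?m (\<epsilon> * y) / ?m y \<le> y * (1 - cdf \<mu> (\<epsilon> * y)) / ?m y"
      using elim by (simp add: diff_divide_distrib)
    also have "\<dots> \<le> y * (1 - cdf \<mu> (\<epsilon> * y)) / ?m (\<epsilon> * y)"
      using T elim le by (intro divide_left_mono) auto
    also have "\<dots> = ?q (\<epsilon> * y) / \<epsilon>" using \<epsilon> by simp
    finally show ?case by simp
  qed
  show "\<forall>\<^sub>F y in at_top. ?m (\<epsilon> * y) / ?m y \<le> 1"
    using pos eventually_gt_at_top[of 0]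
    by eventually_elim (use \<epsilon> in \<open>auto intro!: truncated_mean_mono simp: divide_le_eq_1\<close>)
qed simp

end

section \<open>Control of the tail from a geometric skeleton\<close>

context nonneg_law
begin

text \<open>Knowing the tail up to constants on a sequence with ratios tending to \<open>c\<close> suffices. Between
consecutive points the tail is squeezed by monotonicity, which costs a further constant factor. On the
sequence itself \<open>x (1 - F(x))\<close> is comparable to \<open>p\<^sub>n = z\<^sub>n s(z\<^sub>n)\<close>; by the decay of \<open>s\<close> this grows more
slowly than any geometric sequence, while \<open>m\<close> gains a multiple of \<open>p\<^sub>n\<close> in each step.\<close>

lemma tail_negligible_from_skeleton:
  fixes z :: "nat \<Rightarrow> real" and s :: "real \<Rightarrow> real"
  assumes z_pos: "\<forall>\<^sub>F n in sequentially. 0 < z n"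
    and ratio: "(\<lambda>n. z (Suc n) / z n) \<longlonglongrightarrow> c" and c: "1 < c"
    and s_pos: "\<And>x. 0 < s x" and s_anti: "\<And>x y. x \<le> y \<Longrightarrow> s y \<le> s x"
    and decay: "\<And>\<eta> \<rho>. 0 < \<eta> \<Longrightarrow> \<eta> < 1 \<Longrightarrow> 0 < \<rho> \<Longrightarrow>
      \<forall>\<^sub>F x in at_top. \<eta> * \<rho> * s (\<rho> * x) \<le> s x"
    and b: "0 < b" "\<forall>\<^sub>F n in sequentially. b * s (z n) \<le> 1 - cdf \<mu> (z n)"
    and B: "0 < B" "\<forall>\<^sub>F n in sequentially. 1 - cdf \<mu> (z n) \<le> B * s (z n)"
  shows "((\<lambda>x. x * (1 - cdf \<mu> x) / truncated_mean \<mu> x) \<longlongrightarrow> 0) at_top"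
proof -
  let ?m = "truncated_mean \<mu>"
  define p where "p n = z n * s (z n)" for n
  have z_lim: "filterlim z at_top sequentially" by (rule ratio_limit_at_top[OF z_pos ratio c])
  have z_pos_Suc: "\<forall>\<^sub>F n in sequentially. 0 < z (Suc n)"
    using z_pos by (rule eventually_sequentially_Suc[THEN iffD2])
  have p_pos: "\<forall>\<^sub>F n in sequentially. 0 < p n"
    using z_pos by eventually_elim (simp add: p_def s_pos)
  define q where "q = (1 + c) / 2"
  have q: "1 < q" "q < c" using c by (auto simp: q_def)
  define \<kappa> where "\<kappa> = b * (1 - 1 / q)"
  have \<kappa>: "0 < \<kappa>" using b q by (simp add: \<kappa>_def)
  have inc: "\<forall>\<^sub>F n in sequentially. ?m (z n) + \<kappa> * p (Suc n) \<le> ?m (z (Suc n))"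
    using z_pos z_pos_Suc order_tendstoD(1)[OF ratio q(2)] b(2)[THEN eventually_sequentially_Suc[THEN iffD2]]
  proof eventually_elim
    case (elim n)
    have qz: "q * z n \<le> z (Suc n)" using elim(1,3) by (simp add: pos_less_divide_eq)
    then have gap: "(1 - 1 / q) * z (Suc n) \<le> z (Suc n) - z n" using q by (simp add: field_simps)
    have "1 * z n \<le> q * z n" using elim(1) q by (intro mult_right_mono) auto
    then have "z n \<le> z (Suc n)" using qz by simp
    have "\<kappa> * p (Suc n) = (1 - 1 / q) * z (Suc n) * (b * s (z (Suc n)))"
      by (simp add: \<kappa>_def p_def)
    also have "\<dots> \<le> (z (Suc n) - z n) * (1 - cdf \<mu> (z (Suc n)))"
      using gap elim b(1) s_pos[of "z (Suc n)"] \<open>z n \<le> z (Suc n)\<close> by (intro mult_mono) auto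
    also have "\<dots> \<le> ?m (z (Suc n)) - ?m (z n)"
      using elim \<open>z n \<le> z (Suc n)\<close> by (intro truncated_mean_increment_ge) auto
    finally show ?case by simp
  qed
  have slow: "\<forall>\<^sub>F n in sequentially. \<theta> * p (Suc n) \<le> p n" if \<theta>: "0 < \<theta>" "\<theta> < 1" for \<theta>
  proof -
    \<comment> \<open>Three factors are lost: one in the decay of \<open>s\<close>, and one each for \<open>z\<^sub>n\<^sub>+\<^sub>1 / z\<^sub>n\<close> being only
      approximately \<open>c\<close> from below and from above.\<close>
    define \<sigma> where "\<sigma> = root 3 \<theta>"
    have \<sigma>: "0 < \<sigma>" "\<sigma> < 1" "\<sigma> ^ 3 = \<theta>" using \<theta> by (auto simp: \<sigma>_def)
    have "\<forall>\<^sub>F n in sequentially. \<sigma> * (\<sigma> * c) * s (\<sigma> * c * z n) \<le> s (z n)"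
      using \<sigma> c by (intro eventually_compose_filterlim[OF decay z_lim]) auto
    moreover have "\<forall>\<^sub>F n in sequentially. \<sigma> * c < z (Suc n) / z n"
      using \<sigma> c by (intro order_tendstoD(1)[OF ratio]) simp
    moreover have "\<forall>\<^sub>F n in sequentially. z (Suc n) / z n < c / \<sigma>"
      using \<sigma> c by (intro order_tendstoD(2)[OF ratio]) (simp add: field_simps)
    ultimately show ?thesis
      using z_pos z_pos_Suc
    proof eventually_elim
      case (elim n)
      have "\<sigma> * c * z n \<le> z (Suc n)" using elim(2,4) by (simp add: pos_less_divide_eq)
      then have "\<sigma> * (\<sigma> * c) * s (z (Suc n)) \<le> \<sigma> * (\<sigma> * c) * s (\<sigma> * c * z n)"
        using \<sigma> c by (intro mult_left_mono s_anti) auto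
      then have s_le: "\<sigma> * (\<sigma> * c) * s (z (Suc n)) \<le> s (z n)" using elim(1) by linarith
      have "z (Suc n) < c / \<sigma> * z n" using elim(3,4) by (simp add: pos_divide_less_eq)
      then have z_le: "\<sigma> * z (Suc n) \<le> c * z n" using \<sigma> by (simp add: field_simps)
      have "c * (\<theta> * p (Suc n)) = (\<sigma> * z (Suc n)) * (\<sigma> * (\<sigma> * c) * s (z (Suc n)))"
        by (simp add: p_def \<sigma>(3)[symmetric] power3_eq_cube)
      also have "\<dots> \<le> c * z n * s (z n)"
        using elim(4) \<sigma>(1) c s_pos[of "z (Suc n)"] by (intro mult_mono[OF z_le s_le]) auto
      finally have "c * (\<theta> * p (Suc n)) \<le> c * p n" by (simp add: p_def)
      then show ?case using c by simp
    qed
  qed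
  have m_nonneg: "\<forall>\<^sub>F n in sequentially. 0 \<le> ?m (z n)"
    using z_pos by eventually_elim (simp add: truncated_mean_nonneg)
  have "\<forall>\<^sub>F n in sequentially. 0 < ?m (z (Suc n))"
    using inc m_nonneg p_pos[THEN eventually_sequentially_Suc[THEN iffD2]]
  proof eventually_elim
    case (elim n)
    have "0 < \<kappa> * p (Suc n)" using elim \<kappa> by simp
    then show ?case using elim by linarith
  qed
  then have m_pos: "\<forall>\<^sub>F n in sequentially. 0 < ?m (z n)"
    by (rule eventually_sequentially_Suc[THEN iffD1])
  have pm: "(\<lambda>n. p n / ?m (z n)) \<longlonglongrightarrow> 0"
    by (rule negligible_increment[OF p_pos m_nonneg \<kappa> inc slow])
  show ?thesis
  proof (rule tendstoI)
    fix e :: real assume e: "0 < e"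
    have "\<forall>\<^sub>F n in sequentially. p n / ?m (z n) < e / (2 * c * B)"
      using e c B by (intro order_tendstoD(2)[OF pm]) simp
    moreover have "\<forall>\<^sub>F n in sequentially. z (Suc n) / z n < 2 * c"
      using c by (intro order_tendstoD(2)[OF ratio]) simp
    ultimately have "\<forall>\<^sub>F n in sequentially. 0 < z n \<and> 0 < ?m (z n) \<and> p n / ?m (z n) < e / (2 * c * B)
        \<and> z (Suc n) / z n < 2 * c \<and> 1 - cdf \<mu> (z n) \<le> B * s (z n)"
      using z_pos m_pos B(2) by eventually_elim auto
    then obtain N where N: "\<And>n. N \<le> n \<Longrightarrow> 0 < z n \<and> 0 < ?m (z n) \<and> p n / ?m (z n) < e / (2 * c * B)
        \<and> z (Suc n) / z n < 2 * c \<and> 1 - cdf \<mu> (z n) \<le> B * s (z n)"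
      unfolding eventually_sequentially by blast
    show "\<forall>\<^sub>F x in at_top. dist (x * (1 - cdf \<mu> x) / ?m x) 0 < e"
      using eventually_ge_at_top[of "z N"]
    proof eventually_elim
      case (elim x)
      obtain n where n: "N \<le> n" "z n \<le> x" "x < z (Suc n)"
        using bracketing_index[OF z_lim elim] by blast
      have zn: "0 < z n" and mn: "0 < ?m (z n)" and pn: "p n / ?m (z n) < e / (2 * c * B)"
        and rn: "z (Suc n) / z n < 2 * c" and Tn: "1 - cdf \<mu> (z n) \<le> B * s (z n)"
        using N[OF n(1)] by auto
      have T: "0 \<le> 1 - cdf \<mu> x" "1 - cdf \<mu> x \<le> B * s (z n)"
        using cdf_bounded_prob[of x] cdf_nondecreasing[OF n(2)] Tn by auto
      have "z (Suc n) < 2 * c * z n" using rn zn by (simp add: pos_divide_less_eq)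
      then have "x * (1 - cdf \<mu> x) \<le> 2 * c * z n * (B * s (z n))"
        using T zn n c by (intro mult_mono) auto
      also have "\<dots> = 2 * c * B * p n" by (simp add: p_def)
      finally have "x * (1 - cdf \<mu> x) \<le> 2 * c * B * p n" .
      moreover have "0 \<le> p n" using zn s_pos[of "z n"] by (simp add: p_def)
      ultimately have "x * (1 - cdf \<mu> x) / ?m x \<le> 2 * c * B * p n / ?m (z n)"
        using truncated_mean_mono[of "z n" x] n zn mn c B(1) by (intro frac_le) auto
      also have "\<dots> = 2 * c * B * (p n / ?m (z n))" by simp
      also have "\<dots> < 2 * c * B * (e / (2 * c * B))"
        using pn c B by (intro mult_strict_left_mono) auto
      also have "\<dots> = e" using c B by simp
      finally have "x * (1 - cdf \<mu> x) / ?m x < e" .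
      moreover have "0 \<le> x * (1 - cdf \<mu> x) / ?m x"
        using T zn n truncated_mean_nonneg[of x] by simp
      ultimately show ?case by simp
    qed
  qed
qed

end

section \<open>The renewal theorem\<close>

text \<open>A monotone function has only countably many discontinuities, and the factor \<open>x\<close> does not affect
continuity.\<close>

lemma antimono_quotient_has_continuity_point:
  fixes f :: "real \<Rightarrow> real"
  assumes "antimono_on {0<..} (\<lambda>x. f x / x)"
  shows "\<exists>x>0. isCont f x"
proof -
  let ?g = "\<lambda>x. - (f x / x)"
  have "mono_on {0<..} ?g" using assms by (auto simp: monotone_on_def)
  then have "countable {a \<in> {0<..}. \<not> isCont ?g a}"
    by (intro mono_on_ctble_discont_open) auto
  moreover have "uncountable {1<..<2::real}" by (simp add: uncountable_open_interval)
  ultimately have "\<not> {1<..<2} \<subseteq> {a \<in> {0<..}. \<not> isCont ?g a}"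
    using countable_subset by blast
  then obtain x where x: "1 < x" "isCont ?g x" by auto
  have "isCont (\<lambda>y. - ?g y * y) x" by (intro continuous_intros x(2))
  moreover have "\<forall>\<^sub>F y in nhds x. y \<in> {0<..}"
    using x(1) by (intro eventually_nhds_in_open) auto
  then have "\<forall>\<^sub>F y in nhds x. - ?g y * y = f y"
    by eventually_elim simp
  ultimately have "isCont f x" using isCont_cong by fast
  then show ?thesis using x(1) by (intro exI[of _ x]) auto
qed

theorem corollary2:
  fixes M :: "'a measure" and X :: "'a \<Rightarrow> real" and F :: "real \<Rightarrow> real"
    and c :: real and k :: "nat \<Rightarrow> nat"
    and l1 MR hR :: "real \<Rightarrow> real"
  assumes prob: "prob_space M"
    and X_meas: "X \<in> borel_measurable M"
    and X_nonneg: "AE \<omega> in M. 0 \<le> X \<omega>"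
    and X_mean: "(\<integral>\<^sup>+ \<omega>. ennreal (X \<omega>) \<partial>M) = \<infinity>"
    and F_def: "F = cdf (distr M borel X)"
    and c: "c > 1"
    and k_mono: "strict_mono_on {1..} k"
    and k_pos: "\<And>n. n \<ge> 1 \<Longrightarrow> k n > 0"
    and k_ratio: "(\<lambda>n. real (k (n + 1)) / real (k n)) \<longlonglongrightarrow> c"
    and l1: "slowly_varying 1 l1"
    and MR_pos: "\<And>x. x > 0 \<Longrightarrow> MR x > 0"
    and MR_bdd: "\<exists>B. \<forall>x>0. MR x \<le> B"
    and MR_away: "\<exists>b>0. \<forall>x>0. b \<le> MR x"
    and MR_rcont: "\<And>x. x > 0 \<Longrightarrow> continuous (at_right x) MR"
    and MR_nonconst: "\<exists>x>0. \<exists>y>0. MR x \<noteq> MR y"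
    and MR_period: "\<And>x. x > 0 \<Longrightarrow> MR (c * x) = MR x"
    and MR_antimono: "antimono_on {0<..} (\<lambda>x. MR x / x)"
    and hR_rcont: "\<And>x. x > 0 \<Longrightarrow> continuous (at_right x) hR"
    and hR_lim: "\<And>x. x > 0 \<Longrightarrow> isCont MR x \<Longrightarrow>
                   (\<lambda>n. hR (A_fun l1 (real (k n)) * x)) \<longlonglongrightarrow> 0"
    and tail: "\<forall>\<^sub>F x in at_top. 1 - F x = ell l1 x / x * (MR (delta l1 k x) + hR x)"
  shows "renewal_function (distr M borel X)
           \<sim>[at_top] (\<lambda>y. y / integral {1..y} (\<lambda>u. 1 - F u))"
proof -
  define \<mu> where "\<mu> = distr M borel X"
  interpret M: prob_space M by (rule prob)
  interpret nonneg_law \<mu>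
  proof -
    have "AE x in \<mu>. 0 \<le> x"
      unfolding \<mu>_def by (subst AE_distr_iff) (use X_meas X_nonneg in auto)
    then show "nonneg_law \<mu>"
      using M.real_distribution_distr[OF X_meas]
      unfolding nonneg_law_def nonneg_law_axioms_def \<mu>_def by blast
  qed
  have F: "F = cdf \<mu>" by (simp add: F_def \<mu>_def)
  let ?m = "truncated_mean \<mu>" and ?s = "inverse_scale l1"
  have m_top: "filterlim ?m at_top at_top"
    using X_mean X_meas by (intro truncated_mean_at_top) (simp add: \<mu>_def nn_integral_distr)

  define a where "a n = A_fun l1 (real (k n))" for n
  have k_ge: "1 \<le> real (k n)" if "1 \<le> n" for n using k_pos[OF that] by simp
  have a_pos: "0 < a n" if "1 \<le> n" for n
    using k_ge[OF that] l1 by (auto simp: a_def A_fun_def slowly_varying_def)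
  have k_pos': "\<forall>\<^sub>F n in sequentially. 0 < real (k n)"
    using eventually_ge_at_top[of 1] by eventually_elim (use k_pos in simp)
  have k_ratio': "(\<lambda>n. real (k (Suc n)) / real (k n)) \<longlonglongrightarrow> c" using k_ratio by simp
  have k_top: "filterlim (\<lambda>n. real (k n)) at_top sequentially"
    by (rule ratio_limit_at_top[OF k_pos' k_ratio' c])
  have "(\<lambda>n. real (k (Suc n)) / real (k n) * (l1 (real (k (Suc n))) / l1 (real (k n)))) \<longlonglongrightarrow> c * 1"
    by (intro tendsto_mult k_ratio' slowly_varying_ratio_seq[OF l1 k_top k_ratio' c])
  then have a_ratio: "(\<lambda>n. a (Suc n) / a n) \<longlonglongrightarrow> c" by (simp add: a_def A_fun_def)
  have a_pos': "\<forall>\<^sub>F n in sequentially. 0 < a n"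
    using eventually_ge_at_top[of 1] by eventually_elim (rule a_pos)
  have a_top: "filterlim a at_top sequentially"
    by (rule ratio_limit_at_top[OF a_pos' a_ratio c])
  have unbdd: "\<exists>u\<ge>1. x < A_fun l1 u" for x
  proof -
    have "\<forall>\<^sub>F n in sequentially. x < a n \<and> 1 \<le> n"
      using filterlim_at_top_dense[THEN iffD1, OF a_top, rule_format, of x] eventually_ge_at_top[of 1]
      by eventually_elim auto
    then obtain n where "x < a n" "1 \<le> n" by (auto simp: eventually_sequentially)
    then show ?thesis using k_ge[of n] by (intro exI[of _ "real (k n)"]) (simp add: a_def)
  qed
  have a_unique: "\<forall>\<^sub>F x in at_top. \<exists>!n. 1 \<le> n \<and> a n \<le> x \<and> x < a (Suc n)"
    by (rule unique_bracketing_index[OF _ a_ratio c]) (rule a_pos)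
  \<comment> \<open>Uniqueness of the index makes the definite description in \<open>delta\<close> denote an index \<open>n \<ge> 1\<close>, for
    which \<open>A(k\<^sub>n) > 0\<close>; the bounds on \<open>M\<^sub>R\<close> are available only at positive arguments.\<close>
  have delta_pos: "\<forall>\<^sub>F x in at_top. 0 < delta l1 k x"
    using a_unique eventually_gt_at_top[of 0]
  proof eventually_elim
    case (elim x)
    define n where "n = (THE n. 1 \<le> n \<and> a n \<le> x \<and> x < a (Suc n))"
    have "1 \<le> n \<and> a n \<le> x \<and> x < a (Suc n)"
      unfolding n_def by (rule theI') (rule elim(1))
    then have "0 < x / a n" using a_pos[of n] elim by simp
    moreover have "delta l1 k x = x / a n" by (simp add: delta_def n_def a_def)
    ultimately show ?case by simp
  qed

  obtain b where b: "0 < b" "\<And>x. 0 < x \<Longrightarrow> b \<le> MR x" using MR_away by blast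
  obtain B where B: "\<And>x. 0 < x \<Longrightarrow> MR x \<le> B" using MR_bdd by blast
  have "b \<le> B" using b(2)[of 1] B[of 1] by simp
  obtain x0 where x0: "0 < x0" "isCont MR x0"
    using antimono_quotient_has_continuity_point[OF MR_antimono] by blast
  define z where "z n = a n * x0" for n
  have z_pos: "\<forall>\<^sub>F n in sequentially. 0 < z n"
    using a_pos' by eventually_elim (simp add: z_def x0)
  have z_ratio: "(\<lambda>n. z (Suc n) / z n) \<longlonglongrightarrow> c" using a_ratio x0 by (simp add: z_def)
  have z_top: "filterlim z at_top sequentially" by (rule ratio_limit_at_top[OF z_pos z_ratio c])
  have "(\<lambda>n. \<bar>hR (z n)\<bar>) \<longlonglongrightarrow> 0" using hR_lim[OF x0] by (simp add: z_def a_def tendsto_rabs_zero)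
  then have hR_small: "\<forall>\<^sub>F n in sequentially. \<bar>hR (z n)\<bar> < b / 2"
    using b by (intro order_tendstoD(2)) auto
  have s_pos: "0 < ?s x" for x by (rule inverse_scale_pos[OF unbdd])
  have "\<forall>\<^sub>F n in sequentially. b / 2 * ?s (z n) \<le> 1 - cdf \<mu> (z n)
      \<and> 1 - cdf \<mu> (z n) \<le> 2 * B * ?s (z n)"
    using eventually_compose_filterlim[OF tail z_top] eventually_compose_filterlim[OF delta_pos z_top]
      hR_small z_pos
  proof eventually_elim
    case (elim n)
    define w where "w = MR (delta l1 k (z n)) + hR (z n)"
    have "1 - cdf \<mu> (z n) = w * ?s (z n)"
      using elim by (simp add: F w_def ell_def inverse_scale_def)
    moreover have "b / 2 \<le> w" "w \<le> 2 * B"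
      using elim(3) b(2)[OF elim(2)] B[OF elim(2)] \<open>b \<le> B\<close> b(1) unfolding w_def by linarith+
    then have "b / 2 * ?s (z n) \<le> w * ?s (z n)" "w * ?s (z n) \<le> 2 * B * ?s (z n)"
      using s_pos[of "z n"] by (auto intro: mult_right_mono)
    ultimately show ?case by simp
  qed
  then have lower: "\<forall>\<^sub>F n in sequentially. b / 2 * ?s (z n) \<le> 1 - cdf \<mu> (z n)"
    and upper: "\<forall>\<^sub>F n in sequentially. 1 - cdf \<mu> (z n) \<le> 2 * B * ?s (z n)"
    by (auto elim!: eventually_mono)

  have tail_0: "((\<lambda>x. 1 - cdf \<mu> x) \<longlongrightarrow> 1 - 1) at_top"
    by (intro tendsto_intros cdf_lim_at_top_prob)
  \<comment> \<open>The tail tends to \<open>0\<close> and dominates a multiple of \<open>s\<close> along \<open>z\<^sub>n\<close>; monotonicity of \<open>s\<close> does the rest.\<close>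
  have s_lim: "(?s \<longlongrightarrow> 0) at_top"
  proof (rule order_tendstoI)
    fix e :: real assume "0 < e"
    then have "\<forall>\<^sub>F n in sequentially. 1 - cdf \<mu> (z n) < b / 2 * e"
      using b by (intro order_tendstoD(2)[OF filterlim_compose[OF tail_0 z_top]]) simp
    with lower have "\<forall>\<^sub>F n in sequentially. ?s (z n) < e"
    proof eventually_elim
      case (elim n)
      then have "b / 2 * ?s (z n) < b / 2 * e" by linarith
      then show ?case using b by simp
    qed
    then obtain n where n: "?s (z n) < e" by (auto simp: eventually_sequentially)
    show "\<forall>\<^sub>F x in at_top. ?s x < e"
      using eventually_ge_at_top[of "z n"]
      by eventually_elim (rule le_less_trans[OF inverse_scale_antimono[OF unbdd] n])
  qed (auto intro!: always_eventually less_trans[OF _ s_pos])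

  have rel_tail: "((\<lambda>x. x * (1 - cdf \<mu> x) / ?m x) \<longlongrightarrow> 0) at_top"
    by (rule tail_negligible_from_skeleton[OF z_pos z_ratio c s_pos inverse_scale_antimono[OF unbdd]
          inverse_scale_decay[OF l1 unbdd s_lim] _ lower _ upper])
       (use b \<open>b \<le> B\<close> in auto)
  have m_pos: "\<forall>\<^sub>F y in at_top. 0 < ?m y" using m_top by (simp add: filterlim_at_top_dense)
  have U: "((\<lambda>y. renewal_function \<mu> y * ?m y / y) \<longlongrightarrow> 1) at_top"
    by (rule renewal_function_asymp_truncated_mean[OF truncated_mean_slowly_varying[OF rel_tail m_top] m_pos])
  have "((\<lambda>y. 1 - ?m 1 / ?m y) \<longlongrightarrow> 1 - 0) at_top"
    by (intro tendsto_intros tendsto_divide_0[OF tendsto_const] filterlim_at_top_imp_at_infinity m_top)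
  with U have "((\<lambda>y. renewal_function \<mu> y * ?m y / y * (1 - ?m 1 / ?m y)) \<longlongrightarrow> 1 * (1 - 0)) at_top"
    by (rule tendsto_mult)
  moreover have "\<forall>\<^sub>F y in at_top. renewal_function \<mu> y * ?m y / y * (1 - ?m 1 / ?m y)
      = renewal_function \<mu> y / (y / integral {1..y} (\<lambda>u. 1 - cdf \<mu> u))"
    using m_pos eventually_ge_at_top[of 1]
    by eventually_elim (simp add: integral_tail_eq_truncated_mean_diff field_simps)
  ultimately have "((\<lambda>y. renewal_function \<mu> y / (y / integral {1..y} (\<lambda>u. 1 - cdf \<mu> u)))
      \<longlongrightarrow> 1 * (1 - 0)) at_top"
    by (rule Lim_transform_eventually)
  then show ?thesis
    unfolding F \<mu>_def[symmetric] by (intro asymp_equivI') (simp only: mult_1 diff_zero)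
qed

end
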